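(* Let $X$ be a compact metric space, let $f:X\to X$ be a continuous function, let $A$ be a nowhere dense closed subset of $X$ such that $f(A)\subseteq A$ and $f(X\setminus A)\subseteq X\setminus A$, and let $\sim$ be the equivalence relation on $X$ defined by $$x\sim y \iff x=y \text{ or } x,y\in A \qquad (x,y\in X).$$ Let $f^{\star}:X/_{\sim}\to X/_{\sim}$ be given by $f^{\star}([x])=[f(x)]$. Then the following statements are equivalent. 1. The dynamical system $(X,f)$ is transitive. 2. The dynamical system $(X/_{\sim},f^{\star})$ is transitive.
   Context: $[x]$ denotes the equivalence class of $x$, and $X/_{\sim}$ is the set of equivalence classes with the quotient topology. The map $f^{\star}$ is well defined since $f(A)\subseteq A$. A dynamical system $(Y,g)$ is transitive if for all non-empty open sets $U$ and $V$ in $Y$ there is a non-negative integer $n$ such that $g^n(U)\cap V\neq\emptyset$. *)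

theory Defs
  imports "HOL-Analysis.Analysis"
begin

definition nowhere_dense_in :: "'a topology \<Rightarrow> 'a set \<Rightarrow> bool" where
  "nowhere_dense_in T S \<longleftrightarrow> S \<subseteq> topspace T \<and> T interior_of (T closure_of S) = {}"

text \<open>The map \<open>g\<close> is a total HOL function, but only its values on \<open>topspace T\<close> matter when
  \<open>g\<close> maps \<open>topspace T\<close> to itself.\<close>

definition transitive_system :: "'a topology \<Rightarrow> ('a \<Rightarrow> 'a) \<Rightarrow> bool" where
  "transitive_system T g \<longleftrightarrow>
     (\<forall>U V. openin T U \<and> U \<noteq> {} \<and> openin T V \<and> V \<noteq> {} \<longrightarrow> (\<exists>n::nat. (g ^^ n) ` U \<inter> V \<noteq> {}))"

definition collapse_rel :: "'a set \<Rightarrow> 'a set \<Rightarrow> 'a rel" where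
  "collapse_rel X A = {(x, y). x \<in> X \<and> y \<in> X \<and> (x = y \<or> x \<in> A \<and> y \<in> A)}"

text \<open>The class of \<open>x\<close> under \<open>r\<close> is \<open>r `` {x}\<close>; the topology on \<open>topspace T // r\<close> is the finest one
  making \<open>\<lambda>x. r `` {x}\<close> continuous.\<close>

definition quotient_topology :: "'a topology \<Rightarrow> 'a rel \<Rightarrow> 'a set topology" where
  "quotient_topology T r =
     topology (\<lambda>U. U \<subseteq> topspace T // r \<and> openin T {x \<in> topspace T. r `` {x} \<in> U})"

text \<open>The map \<open>[x] \<mapsto> [f x]\<close>. If \<open>f\<close> preserves \<open>r\<close>, the sets \<open>r `` {f x}\<close> for \<open>x \<in> C\<close> all
  coincide, so that their union is their common value.\<close>

definition quotient_fun :: "'a rel \<Rightarrow> ('a \<Rightarrow> 'a) \<Rightarrow> 'a set \<Rightarrow> 'a set" where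
  "quotient_fun r f C = (\<Union>x\<in>C. r `` {f x})"

lemma openin_quotient_topology:
  "openin (quotient_topology T r) U \<longleftrightarrow>
     U \<subseteq> topspace T // r \<and> openin T {x \<in> topspace T. r `` {x} \<in> U}"
proof -
  have "istopology (\<lambda>U. U \<subseteq> topspace T // r \<and> openin T {x \<in> topspace T. r `` {x} \<in> U})"
    unfolding istopology_def
  proof (intro conjI allI impI)
    fix S S'
    assume "S \<subseteq> topspace T // r \<and> openin T {x \<in> topspace T. r `` {x} \<in> S}"
      and "S' \<subseteq> topspace T // r \<and> openin T {x \<in> topspace T. r `` {x} \<in> S'}"
    moreover have "{x \<in> topspace T. r `` {x} \<in> S \<inter> S'} =
        {x \<in> topspace T. r `` {x} \<in> S} \<inter> {x \<in> topspace T. r `` {x} \<in> S'}"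
      by auto
    ultimately show "S \<inter> S' \<subseteq> topspace T // r" "openin T {x \<in> topspace T. r `` {x} \<in> S \<inter> S'}"
      by auto
  next
    fix \<K>
    assume K: "\<forall>K\<in>\<K>. K \<subseteq> topspace T // r \<and> openin T {x \<in> topspace T. r `` {x} \<in> K}"
    then show "\<Union>\<K> \<subseteq> topspace T // r" by blast
    have "{x \<in> topspace T. r `` {x} \<in> \<Union>\<K>} = (\<Union>K\<in>\<K>. {x \<in> topspace T. r `` {x} \<in> K})"
      by auto
    then show "openin T {x \<in> topspace T. r `` {x} \<in> \<Union>\<K>}"
      using K by auto
  qed
  then show ?thesis
    by (simp add: quotient_topology_def)
qed

lemma topspace_quotient_topology [simp]:
  "topspace (quotient_topology T r) = topspace T // r"
proof
  show "topspace (quotient_topology T r) \<subseteq> topspace T // r"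
    using openin_quotient_topology[of T r "topspace (quotient_topology T r)"] by simp
  have "{x \<in> topspace T. r `` {x} \<in> topspace T // r} = topspace T"
    by (auto simp: quotient_def)
  then have "openin (quotient_topology T r) (topspace T // r)"
    by (simp add: openin_quotient_topology)
  then show "topspace T // r \<subseteq> topspace (quotient_topology T r)"
    by (rule openin_subset)
qed

lemma quotient_map_quotient_topology:
  "quotient_map T (quotient_topology T r) (\<lambda>x. r `` {x})"
  by (auto simp: quotient_map_def openin_quotient_topology quotient_def)

lemma equiv_collapse_rel: "equiv X (collapse_rel X A)"
  by (auto simp: equiv_def refl_on_def sym_def trans_def collapse_rel_def)

lemma quotient_fun_class:
  assumes "f ` X \<subseteq> X" "f ` A \<subseteq> A" "x \<in> X"
  shows "quotient_fun (collapse_rel X A) f (collapse_rel X A `` {x}) = collapse_rel X A `` {f x}"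
  using assms by (auto simp: quotient_fun_def collapse_rel_def)

lemma continuous_map_quotient_fun:
  assumes f: "continuous_map T T f" and A: "f ` A \<subseteq> A"
  defines "r \<equiv> collapse_rel (topspace T) A"
  shows "continuous_map (quotient_topology T r) (quotient_topology T r) (quotient_fun r f)"
proof -
  have fX: "f ` topspace T \<subseteq> topspace T"
    using f by (simp add: continuous_map_image_subset_topspace)
  have "continuous_map T (quotient_topology T r) ((\<lambda>x. r `` {x}) \<circ> f)"
    using f quotient_imp_continuous_map[OF quotient_map_quotient_topology]
    by (rule continuous_map_compose)
  then have "continuous_map T (quotient_topology T r) (quotient_fun r f \<circ> (\<lambda>x. r `` {x}))"
    by (rule continuous_map_eq) (simp add: r_def quotient_fun_class[OF fX A])
  then show ?thesis
    by (rule continuous_compose_quotient_map[OF quotient_map_quotient_topology])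
qed

end

theory Submission
  imports Defs
begin

text \<open>
  The projection \<open>p\<close> to the quotient is a semiconjugacy from \<open>f\<close> to \<open>f\<^sup>\<star>\<close>, so an orbit segment
  of \<open>f\<close> projects to an orbit segment of \<open>f\<^sup>\<star>\<close>; as preimages of open sets under the continuous
  surjection \<open>p\<close> are open and non-empty, transitivity passes from \<open>f\<close> to \<open>f\<^sup>\<star>\<close>
  (\<open>transitive_system_factor\<close>).

  Transitivity can be lifted along a semiconjugacy as soon as every non-empty open set upstairs
  contains the full preimage of a non-empty open set downstairs: an orbit of the factor joining two
  such sets then lifts, from any point of the fibre, to an orbit joining the given sets
  (\<open>transitive_system_lift\<close>). Collapsing \<open>A\<close> has this property because \<open>A\<close> is closed and nowhere
  dense: removing \<open>A\<close> from a non-empty open set \<open>U\<close> leaves a non-empty open set, and off \<open>A\<close> the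
  projection is injective, so that \<open>U - A\<close> is the full preimage of its image
  (\<open>collapse_open_contains_preimage\<close>).
\<close>

lemma semiconjugacy_funpow:
  assumes "f ` X \<subseteq> X" and "\<And>x. x \<in> X \<Longrightarrow> p (f x) = g (p x)" and "x \<in> X"
  shows "(f ^^ n) x \<in> X" and "p ((f ^^ n) x) = (g ^^ n) (p x)"
proof -
  have "(f ^^ n) x \<in> X \<and> p ((f ^^ n) x) = (g ^^ n) (p x)"
    using assms by (induction n) auto
  then show "(f ^^ n) x \<in> X" and "p ((f ^^ n) x) = (g ^^ n) (p x)"
    by auto
qed

lemma transitive_system_factor:
  assumes trans: "transitive_system T f"
    and f: "f ` topspace T \<subseteq> topspace T"
    and cont: "continuous_map T S p" and surj: "p ` topspace T = topspace S"
    and semi: "\<And>x. x \<in> topspace T \<Longrightarrow> p (f x) = g (p x)"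
  shows "transitive_system S g"
  unfolding transitive_system_def
proof (intro allI impI)
  fix U V
  assume UV: "openin S U \<and> U \<noteq> {} \<and> openin S V \<and> V \<noteq> {}"
  let ?pre = "\<lambda>W. {x \<in> topspace T. p x \<in> W}"
  have pre: "openin T (?pre W) \<and> ?pre W \<noteq> {}" if W: "openin S W" "W \<noteq> {}" for W
  proof
    show "openin T (?pre W)"
      using cont W(1) by (rule openin_continuous_map_preimage)
    obtain w where w: "w \<in> W"
      using W(2) by blast
    then have "w \<in> p ` topspace T"
      using openin_subset[OF W(1)] surj by auto
    then show "?pre W \<noteq> {}"
      using w by auto
  qed
  obtain n where "(f ^^ n) ` ?pre U \<inter> ?pre V \<noteq> {}"
    using trans pre UV unfolding transitive_system_def by meson
  then obtain x where x: "x \<in> topspace T" "p x \<in> U" "p ((f ^^ n) x) \<in> V"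
    by blast
  then have "(g ^^ n) (p x) \<in> V"
    using semiconjugacy_funpow(2)[of f "topspace T" p g, OF f semi] by simp
  then show "\<exists>n. (g ^^ n) ` U \<inter> V \<noteq> {}"
    using x by blast
qed

text \<open>
  The hypothesis \<open>irred\<close> makes membership in an open set upstairs detectable downstairs: it suffices
  that the image point lies in the smaller open set \<open>W\<close>, whichever point of the fibre was chosen.
\<close>

lemma transitive_system_lift:
  assumes trans: "transitive_system S g"
    and f: "f ` topspace T \<subseteq> topspace T"
    and surj: "p ` topspace T = topspace S"
    and semi: "\<And>x. x \<in> topspace T \<Longrightarrow> p (f x) = g (p x)"
    and irred: "\<And>U. openin T U \<Longrightarrow> U \<noteq> {} \<Longrightarrow>
      \<exists>W. openin S W \<and> W \<noteq> {} \<and> {x \<in> topspace T. p x \<in> W} \<subseteq> U"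
  shows "transitive_system T f"
  unfolding transitive_system_def
proof (intro allI impI)
  fix U V
  assume UV: "openin T U \<and> U \<noteq> {} \<and> openin T V \<and> V \<noteq> {}"
  obtain U' where U': "openin S U'" "U' \<noteq> {}" "{x \<in> topspace T. p x \<in> U'} \<subseteq> U"
    using irred UV by meson
  obtain V' where V': "openin S V'" "V' \<noteq> {}" "{x \<in> topspace T. p x \<in> V'} \<subseteq> V"
    using irred UV by meson
  obtain n where "(g ^^ n) ` U' \<inter> V' \<noteq> {}"
    using trans U' V' unfolding transitive_system_def by meson
  then obtain w where w: "w \<in> U'" "(g ^^ n) w \<in> V'"
    by blast
  then have "w \<in> p ` topspace T"
    using openin_subset[OF U'(1)] surj by auto
  then obtain x where x: "x \<in> topspace T" "w = p x"
    by blast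
  have "(f ^^ n) x \<in> topspace T" "p ((f ^^ n) x) \<in> V'"
    using semiconjugacy_funpow[of f "topspace T" p g, OF f semi x(1)] w x by auto
  then have "x \<in> U" "(f ^^ n) x \<in> V"
    using w x U'(3) V'(3) by auto
  then show "\<exists>n. (f ^^ n) ` U \<inter> V \<noteq> {}"
    by blast
qed

lemma nowhere_dense_closed_Diff_nonempty:
  assumes A: "closedin T A" "nowhere_dense_in T A" and U: "openin T U" "U \<noteq> {}"
  shows "U - A \<noteq> {}"
proof
  assume "U - A = {}"
  then have "U \<subseteq> T interior_of A"
    using U(1) by (simp add: interior_of_maximal)
  then show False
    using A U(2) by (simp add: nowhere_dense_in_def closure_of_closedin)
qed

text \<open>The witness is the image of \<open>U - A\<close>, all of whose points have singleton classes.\<close>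

lemma collapse_open_contains_preimage:
  fixes T :: "'a topology" and A :: "'a set"
  defines "r \<equiv> collapse_rel (topspace T) A"
  assumes A: "closedin T A" "nowhere_dense_in T A" and U: "openin T U" "U \<noteq> {}"
  shows "\<exists>W. openin (quotient_topology T r) W \<and> W \<noteq> {} \<and> {x \<in> topspace T. r `` {x} \<in> W} \<subseteq> U"
proof (intro exI conjI)
  let ?W = "(\<lambda>x. r `` {x}) ` (U - A)"
  have sub: "U \<subseteq> topspace T"
    using U(1) by (rule openin_subset)
  have eq: "x = y" if "y \<in> U - A" "r `` {x} = r `` {y}" for x y
  proof -
    have "y \<in> r `` {x}"
      using that sub by (simp add: r_def collapse_rel_def subset_iff)
    then show "x = y"
      using that(1) by (simp add: r_def collapse_rel_def)
  qed
  have pre: "{x \<in> topspace T. r `` {x} \<in> ?W} = U - A"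
    using eq sub by blast
  have "openin T (U - A)"
    using U(1) A(1) by (rule openin_diff)
  moreover have "?W \<subseteq> topspace T // r"
    using sub by (auto simp: quotient_def)
  ultimately show "openin (quotient_topology T r) ?W"
    by (simp add: openin_quotient_topology pre)
  show "?W \<noteq> {}"
    using nowhere_dense_closed_Diff_nonempty[OF A U] by simp
  show "{x \<in> topspace T. r `` {x} \<in> ?W} \<subseteq> U"
    unfolding pre by (rule Diff_subset)
qed

theorem theorem3p17:
  fixes X :: "'a metric" and f :: "'a \<Rightarrow> 'a" and A :: "'a set"
  assumes "compact_space (mtopology_of X)"
    and "continuous_map (mtopology_of X) (mtopology_of X) f"
    and "closedin (mtopology_of X) A"
    and "nowhere_dense_in (mtopology_of X) A"
    and "f ` A \<subseteq> A"
    and "f ` (mspace X - A) \<subseteq> mspace X - A"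
  shows "transitive_system (mtopology_of X) f \<longleftrightarrow>
    transitive_system (quotient_topology (mtopology_of X) (collapse_rel (mspace X) A))
      (quotient_fun (collapse_rel (mspace X) A) f)"
proof -
  let ?T = "mtopology_of X"
  let ?r = "collapse_rel (mspace X) A"
  let ?p = "\<lambda>x. ?r `` {x}"
  have f: "f ` topspace ?T \<subseteq> topspace ?T"
    using assms(2) by (rule continuous_map_image_subset_topspace)
  have quot: "quotient_map ?T (quotient_topology ?T ?r) ?p"
    by (rule quotient_map_quotient_topology)
  note cont = quotient_imp_continuous_map[OF quot]
  note surj = quotient_imp_surjective_map[OF quot]
  have semi: "?p (f x) = quotient_fun ?r f (?p x)" if "x \<in> topspace ?T" for x
    using quotient_fun_class[of f "mspace X" A x] f assms(5) that by simp
  have irred: "\<exists>W. openin (quotient_topology ?T ?r) W \<and> W \<noteq> {} \<and> {x \<in> topspace ?T. ?p x \<in> W} \<subseteq> U"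
    if "openin ?T U" "U \<noteq> {}" for U
    using collapse_open_contains_preimage[OF assms(3,4) that] by simp
  show ?thesis
  proof
    assume "transitive_system ?T f"
    then show "transitive_system (quotient_topology ?T ?r) (quotient_fun ?r f)"
      using f cont surj semi by (rule transitive_system_factor)
  next
    assume "transitive_system (quotient_topology ?T ?r) (quotient_fun ?r f)"
    then show "transitive_system ?T f"
      using f surj semi irred by (rule transitive_system_lift)
  qed
qed

end
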